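(* Let $\gamma,\alpha$ be umbrae and let $(\gamma,\alpha)$ be the exponential Riordan array they generate. Then for all $n\ge k\ge1$: \[ (\gamma,\alpha)_{n,k}\simeq\frac{n}{k}\sum_{i=0}^{n-k}\binom{n-1}{i}\alpha^i\,(\gamma,\alpha)_{n-1-i,k-1}, \] \[ (\gamma,\alpha)_{n,k}\simeq\frac{n}{k}\sum_{i=0}^{n-k}\binom{k-1+i}{i}\mathfrak K_\alpha^i\,(\gamma,\alpha)_{n-1,k-1+i}, \] \[ (\gamma,\alpha)_{n,k}\simeq\binom{n}{k}\sum_{i=0}^{n-k}(k.\mathfrak K_\alpha)^i\,(\gamma,\alpha)_{n-k,i}. \]
   Context: Classical umbral calculus: $R=\mathbb{C}[x]$, $A$ a saturated alphabet of umbrae, $E:R[A]\to R$ linear with $E[1]=1$ and $E[\alpha^i\beta^j\cdots]=E[\alpha^i]E[\beta^j]\cdots$ for distinct umbrae; $p\simeq q$ means $E[p]=E[q]$. $f_\alpha(t)=\sum_n E[\alpha^n]t^n/n!$. For an integer $x$ (possibly negative), $x.\alpha$ is an umbra with $(x.\alpha)^n\simeq n![t^n]f_\alpha(t)^x$. For umbrae $\sigma,\alpha$, $\mathfrak K_{\sigma,\alpha}$ is an umbra with $\mathfrak K_{\sigma,\alpha}^0=1$ and $\mathfrak K_{\sigma,\alpha}^n\simeq\sigma(\sigma+(-n).\alpha)^{n-1}$ for $n\ge1$ ($(-n).\alpha$ uncorrelated with $\sigma$); $\mathfrak K_\alpha:=\mathfrak K_{\alpha,\alpha}$. The exponential Riordan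 array $(\gamma,\alpha)$ is the lower triangular matrix with entries $(\gamma,\alpha)_{n,k}=E\big[\binom{n}{k}(\gamma+k.\alpha)^{n-k}\big]\in R$ for $n\ge k\ge0$, with $\gamma$ and $k.\alpha$ uncorrelated; in classical terms $(\gamma,\alpha)_{n,k}=n![t^n]f_\gamma(t)\frac{(tf_\alpha(t))^k}{k!}$. *)

theory Defs
  imports
    Complex_Main
    "HOL-Library.Poly_Mapping"
    "HOL-Computational_Algebra.Computational_Algebra"
begin

text \<open>
  The coefficient ring is \<open>R = \<complex>[x]\<close>, rendered as \<^typ>\<open>complex poly\<close>. The alphabet \<open>A\<close> is the
  set of all elements of a type \<open>'a\<close>, and \<open>R[A]\<close> is the monoid algebra over \<open>R\<close> of the
  finitely supported exponent vectors \<open>'a \<Rightarrow>\<^sub>0 nat\<close>.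
\<close>

type_synonym 'a umbral_poly = "('a \<Rightarrow>\<^sub>0 nat) \<Rightarrow>\<^sub>0 complex poly"

definition umb :: "'a \<Rightarrow> 'a umbral_poly" where
  "umb \<alpha> = Poly_Mapping.single (Poly_Mapping.single \<alpha> 1) 1"

definition scal :: "complex poly \<Rightarrow> 'a umbral_poly" where
  "scal c = Poly_Mapping.single 0 c"

locale umbral_calculus =
  fixes E :: "'a umbral_poly \<Rightarrow> complex poly"
  assumes E_add: "E (p + q) = E p + E q"
    and E_scal: "E (scal c * p) = c * E p"
    and E_one: "E 1 = 1"
    and E_uncorrelated:
      "finite S \<Longrightarrow> E (\<Prod>\<alpha>\<in>S. umb \<alpha> ^ i \<alpha>) = (\<Prod>\<alpha>\<in>S. E (umb \<alpha> ^ i \<alpha>))"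
    and saturated:
      "a 0 = 1 \<Longrightarrow> infinite {\<alpha>. \<forall>n. E (umb \<alpha> ^ n) = a n}"

definition umbral_equiv ::
    "'a umbral_poly \<Rightarrow> ('a umbral_poly \<Rightarrow> complex poly) \<Rightarrow> 'a umbral_poly \<Rightarrow> bool"
    ("(_ \<simeq>\<^bsub>_\<^esub> _)" [51, 0, 51] 50) where
  "p \<simeq>\<^bsub>E\<^esub> q \<longleftrightarrow> E p = E q"

definition gen_fun :: "('a umbral_poly \<Rightarrow> complex poly) \<Rightarrow> 'a \<Rightarrow> complex poly fps" where
  "gen_fun E \<alpha> = Abs_fps (\<lambda>n. smult (1 / fact n) (E (umb \<alpha> ^ n)))"

text \<open>
  Integer powers of a power series with constant term 1. The type \<^typ>\<open>complex poly\<close> has no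
  \<^const>\<open>inverse\<close>, hence the ring version of the inverse of a power series, whose second argument
  is the inverse of the constant term.
\<close>

definition fps_int_pow :: "'a::comm_ring_1 fps \<Rightarrow> int \<Rightarrow> 'a fps" where
  "fps_int_pow f x = (if 0 \<le> x then f ^ nat x else fps_left_inverse f 1 ^ nat (- x))"

definition is_dot :: "('a umbral_poly \<Rightarrow> complex poly) \<Rightarrow> int \<Rightarrow> 'a \<Rightarrow> 'a \<Rightarrow> bool" where
  "is_dot E x \<alpha> \<beta> \<longleftrightarrow>
    (\<forall>n. E (umb \<beta> ^ n) = smult (fact n) (fps_nth (fps_int_pow (gen_fun E \<alpha>) x) n))"

text \<open>
  The umbra \<open>x.\<alpha>\<close>. The finite set \<open>F\<close> lists the umbrae from which \<open>x.\<alpha>\<close> has to be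
  uncorrelated, that is, distinct.
\<close>

definition dot :: "('a umbral_poly \<Rightarrow> complex poly) \<Rightarrow> 'a set \<Rightarrow> int \<Rightarrow> 'a \<Rightarrow> 'a" where
  "dot E F x \<alpha> = (SOME \<beta>. \<beta> \<notin> F \<and> is_dot E x \<alpha> \<beta>)"

definition is_K_umbra :: "('a umbral_poly \<Rightarrow> complex poly) \<Rightarrow> 'a \<Rightarrow> 'a \<Rightarrow> 'a \<Rightarrow> bool" where
  "is_K_umbra E \<sigma> \<alpha> \<kappa> \<longleftrightarrow>
    umb \<kappa> ^ 0 = 1 \<and>
    (\<forall>n\<ge>1. umb \<kappa> ^ n \<simeq>\<^bsub>E\<^esub> umb \<sigma> * (umb \<sigma> + umb (dot E {\<sigma>} (- int n) \<alpha>)) ^ (n - 1))"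

definition K_umbra :: "('a umbral_poly \<Rightarrow> complex poly) \<Rightarrow> 'a \<Rightarrow> 'a \<Rightarrow> 'a" where
  "K_umbra E \<sigma> \<alpha> = (SOME \<kappa>. is_K_umbra E \<sigma> \<alpha> \<kappa>)"

definition riordan ::
    "('a umbral_poly \<Rightarrow> complex poly) \<Rightarrow> 'a \<Rightarrow> 'a \<Rightarrow> nat \<Rightarrow> nat \<Rightarrow> complex poly" where
  "riordan E \<gamma> \<alpha> n k =
    (if k \<le> n then E (of_nat (n choose k) * (umb \<gamma> + umb (dot E {\<gamma>} (int k) \<alpha>)) ^ (n - k))
     else 0)"


text \<open>Saturation makes the choices above succeed.\<close>

lemma fps_int_pow_nth_0:
  assumes "fps_nth f 0 = 1"
  shows "fps_nth (fps_int_pow f x) 0 = 1"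
  using assms by (simp add: fps_int_pow_def fps_nth_power_0)

context umbral_calculus
begin

lemma is_dot_dot:
  assumes "finite F"
  shows "dot E F x \<alpha> \<notin> F" and "is_dot E x \<alpha> (dot E F x \<alpha>)"
proof -
  let ?a = "\<lambda>n. smult (fact n) (fps_nth (fps_int_pow (gen_fun E \<alpha>) x) n)"
  have "?a 0 = 1"
    by (simp add: fps_int_pow_nth_0 gen_fun_def E_one)
  from saturated[of ?a, OF this] have "infinite {\<beta>. is_dot E x \<alpha> \<beta>}"
    by (simp add: is_dot_def)
  then have "infinite ({\<beta>. is_dot E x \<alpha> \<beta>} - F)"
    using assms by simp
  then have "{\<beta>. is_dot E x \<alpha> \<beta>} - F \<noteq> {}"
    by (metis finite.emptyI)
  then have "\<exists>\<beta>. \<beta> \<notin> F \<and> is_dot E x \<alpha> \<beta>"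
    by blast
  from someI_ex[OF this]
  show "dot E F x \<alpha> \<notin> F" "is_dot E x \<alpha> (dot E F x \<alpha>)"
    by (simp_all add: dot_def)
qed

lemma is_K_umbra_K_umbra: "is_K_umbra E \<sigma> \<alpha> (K_umbra E \<sigma> \<alpha>)"
proof -
  let ?a = "\<lambda>n. if n = 0 then 1
    else E (umb \<sigma> * (umb \<sigma> + umb (dot E {\<sigma>} (- int n) \<alpha>)) ^ (n - 1))"
  have "infinite {\<kappa>. \<forall>n. E (umb \<kappa> ^ n) = ?a n}"
    by (rule saturated) simp
  then have "{\<kappa>. \<forall>n. E (umb \<kappa> ^ n) = ?a n} \<noteq> {}"
    by (metis (lifting) finite.emptyI)
  then obtain \<kappa> where \<kappa>: "\<And>n. E (umb \<kappa> ^ n) = ?a n"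
    by blast
  have "is_K_umbra E \<sigma> \<alpha> \<kappa>"
    using \<kappa> by (simp add: is_K_umbra_def umbral_equiv_def)
  then show ?thesis
    unfolding K_umbra_def by (rule someI)
qed

end


text \<open>A model of the axioms: an umbra is a moment sequence together with an index.\<close>

definition model_moment :: "(nat \<Rightarrow> complex poly) \<times> nat \<Rightarrow> nat \<Rightarrow> complex poly" where
  "model_moment \<alpha> n = (if n = 0 then 1 else fst \<alpha> n)"

definition model_mono :: "((nat \<Rightarrow> complex poly) \<times> nat \<Rightarrow>\<^sub>0 nat) \<Rightarrow> complex poly" where
  "model_mono m = (\<Prod>\<alpha>\<in>Poly_Mapping.keys m. model_moment \<alpha> (Poly_Mapping.lookup m \<alpha>))"

definition model_E :: "((nat \<Rightarrow> complex poly) \<times> nat) umbral_poly \<Rightarrow> complex poly" where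
  "model_E p = (\<Sum>m\<in>Poly_Mapping.keys p. Poly_Mapping.lookup p m * model_mono m)"

lemma model_E_superset:
  assumes "finite T" "Poly_Mapping.keys p \<subseteq> T"
  shows "model_E p = (\<Sum>m\<in>T. Poly_Mapping.lookup p m * model_mono m)"
  unfolding model_E_def using assms by (intro sum.mono_neutral_left) (auto simp: in_keys_iff)

lemma model_mono_superset:
  assumes "finite T" "Poly_Mapping.keys m \<subseteq> T"
  shows "model_mono m = (\<Prod>\<alpha>\<in>T. model_moment \<alpha> (Poly_Mapping.lookup m \<alpha>))"
  unfolding model_mono_def using assms
  by (intro prod.mono_neutral_left) (auto simp: in_keys_iff model_moment_def)

lemma model_E_single: "model_E (Poly_Mapping.single m c) = c * model_mono m"
  by (subst model_E_superset[of "{m}"]) auto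

lemma umb_power: "umb \<alpha> ^ n = Poly_Mapping.single (Poly_Mapping.single \<alpha> n) 1"
  by (induction n) (simp_all add: umb_def mult_single flip: single_add)

lemma prod_umb_power:
  "finite S \<Longrightarrow> (\<Prod>\<alpha>\<in>S. umb \<alpha> ^ i \<alpha>)
    = Poly_Mapping.single (\<Sum>\<alpha>\<in>S. Poly_Mapping.single \<alpha> (i \<alpha>)) 1"
  by (induction S rule: finite_induct) (simp_all add: umb_power mult_single)

lemma lookup_sum_single:
  "finite S \<Longrightarrow> Poly_Mapping.lookup (\<Sum>\<alpha>\<in>S. Poly_Mapping.single \<alpha> (i \<alpha> :: nat)) \<beta>
    = (if \<beta> \<in> S then i \<beta> else 0)"
  by (induction S rule: finite_induct) (auto simp: lookup_add lookup_single when_def)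

lemma model_E_umb_power: "model_E (umb \<alpha> ^ n) = model_moment \<alpha> n"
  unfolding umb_power model_E_single
  by (subst model_mono_superset[of "{\<alpha>}"]) auto

lemma umbral_calculus_model: "umbral_calculus model_E"
proof
  fix p q :: "((nat \<Rightarrow> complex poly) \<times> nat) umbral_poly"
  let ?T = "Poly_Mapping.keys p \<union> Poly_Mapping.keys q"
  have "model_E (p + q) = (\<Sum>m\<in>?T. Poly_Mapping.lookup (p + q) m * model_mono m)"
    by (rule model_E_superset) (use Poly_Mapping.keys_add[of p q] in auto)
  also have "\<dots> = model_E p + model_E q"
    by (simp add: model_E_superset[of ?T] lookup_add sum.distrib ring_distribs)
  finally show add: "model_E (p + q) = model_E p + model_E q" .
next
  fix c and p :: "((nat \<Rightarrow> complex poly) \<times> nat) umbral_poly"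
  have lk: "Poly_Mapping.lookup (scal c * p) m = c * Poly_Mapping.lookup p m" for m
    by (simp add: scal_def mult_map_scale_conv_mult[symmetric] Poly_Mapping.map.rep_eq when_def)
  have "model_E (scal c * p)
      = (\<Sum>m\<in>Poly_Mapping.keys p. Poly_Mapping.lookup (scal c * p) m * model_mono m)"
    by (rule model_E_superset) (auto simp: in_keys_iff lk)
  then show "model_E (scal c * p) = c * model_E p"
    by (simp add: lk model_E_def sum_distrib_left mult.assoc)
next
  show "model_E 1 = 1"
    by (simp add: model_E_def model_mono_def)
next
  fix S :: "((nat \<Rightarrow> complex poly) \<times> nat) set" and i
  assume S: "finite S"
  have "model_mono (\<Sum>\<alpha>\<in>S. Poly_Mapping.single \<alpha> (i \<alpha>)) = (\<Prod>\<alpha>\<in>S. model_moment \<alpha> (i \<alpha>))"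
    using S by (subst model_mono_superset[of S])
      (auto simp: in_keys_iff lookup_sum_single split: if_splits)
  then show "model_E (\<Prod>\<alpha>\<in>S. umb \<alpha> ^ i \<alpha>) = (\<Prod>\<alpha>\<in>S. model_E (umb \<alpha> ^ i \<alpha>))"
    using S by (simp add: prod_umb_power model_E_single model_E_umb_power)
next
  fix a :: "nat \<Rightarrow> complex poly"
  assume "a 0 = 1"
  then have "range (Pair a) \<subseteq> {\<alpha>. \<forall>n. model_E (umb \<alpha> ^ n) = a n}"
    by (auto simp: model_E_umb_power model_moment_def)
  moreover have "infinite (range (Pair a :: nat \<Rightarrow> _))"
    by (rule range_inj_infinite) (simp add: inj_on_def)
  ultimately show "infinite {\<alpha>. \<forall>n. model_E (umb \<alpha> ^ n) = a n}"
    using finite_subset by blast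
qed

end

theory Submission
  imports Defs
begin

text \<open>
  Write \<open>f\<close>, \<open>g\<close> and \<open>\<kappa>\<close> for the generating functions of \<open>\<alpha>\<close>, \<open>\<gamma>\<close> and \<open>\<KK>\<^sub>\<alpha>\<close>. The entries of
  the array are \<open>n!/k! [t\<^bsup>n-k\<^esup>] g f\<^sup>k\<close>, so the first identity is \<open>g f\<^sup>k = f \<cdot> g f\<^bsup>k-1\<^esup>\<close>. The moments
  of \<open>\<KK>\<^sub>\<alpha>\<close> satisfy \<open>n [t\<^sup>n] \<kappa> = [t\<^bsup>n-1\<^esup>] f' f\<^bsup>-n\<^esup>\<close>, which by Lagrange inversion means
  \<open>f = \<kappa>(t f)\<close>. Replacing one factor \<open>f\<close> of \<open>g f\<^sup>k\<close> by \<open>\<kappa>(t f)\<close> gives the second identity,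
  and replacing all \<open>k\<close> of them gives the third.
\<close>

section \<open>Coefficients of compositions and Lagrange inversion for power series\<close>

lemma fps_mult_compose_nth:
  fixes a b c :: "'a::comm_ring_1 fps"
  assumes "b $ 0 = 0"
  shows "(c * (a oo b)) $ n = (\<Sum>i=0..n. a $ i * (c * b ^ i) $ n)"
proof -
  \<comment> \<open>Since \<open>b ^ i\<close> starts at degree \<open>i\<close> or later, the range
    can be extended to \<open>n\<close> for every \<open>j\<close>, so that the two sums can be
    swapped.\<close>
  have comp: "(a oo b) $ j = (\<Sum>i=0..n. a $ i * (b ^ i) $ j)" if "j \<le> n" for j
    unfolding fps_compose_nth
    by (rule sum.mono_neutral_left) (use that startsby_zero_power_prefix[OF assms] in auto)
  have "(c * (a oo b)) $ n = (\<Sum>j=0..n. \<Sum>i=0..n. c $ j * (a $ i * (b ^ i) $ (n - j)))"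
    by (simp add: fps_mult_nth comp sum_distrib_left)
  also have "\<dots> = (\<Sum>i=0..n. \<Sum>j=0..n. c $ j * (a $ i * (b ^ i) $ (n - j)))"
    by (rule sum.swap)
  also have "\<dots> = (\<Sum>i=0..n. a $ i * (c * b ^ i) $ n)"
    by (simp add: fps_mult_nth sum_distrib_left ac_simps)
  finally show ?thesis .
qed

text \<open>The factor \<open>fps_X ^ i\<close> shifts the index by \<open>i\<close>. With
  \<open>c\<close> of the form g f^l, the coefficients on the right are entries of the array up to
  factorials.\<close>

lemma fps_mult_compose_X_mult_nth:
  fixes a c f :: "'a::comm_ring_1 fps"
  shows "(c * (a oo (fps_X * f))) $ n = (\<Sum>i=0..n. a $ i * (c * f ^ i) $ (n - i))"
  by (subst fps_mult_compose_nth)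
     (auto simp: power_mult_distrib mult.left_commute[of c] fps_X_power_mult_nth intro!: sum.cong)

text \<open>
  In residue notation this is \<open>Res (t f)\<^bsup>-m-1\<^esup> d(t f)\<close>, which vanishes for \<open>m > 0\<close> because the
  integrand is then exact.
\<close>

lemma fps_residue_X_mult:
  fixes f w :: "'a::{idom,ring_char_0} fps"
  assumes "w * f = 1"
  shows "(fps_deriv (fps_X * f) * w ^ Suc m) $ m = (if m = 0 then 1 else 0)"
proof -
  have fw: "f * (w * z) = z" for z
    using assms by (metis mult.assoc mult.commute mult_1)
  have "fps_deriv (w * f) = 0"
    by (simp add: assms)
  then have "w * fps_deriv f = - (fps_deriv w * f)"
    by (simp add: eq_neg_iff_add_eq_0)
  \<comment> \<open>Exactness: the right-hand side is -1/m times the derivative of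
    \<open>w ^ m\<close>.\<close>
  then have dw: "fps_deriv f * w ^ Suc m = - (fps_deriv w * w ^ (m - 1))" if "m > 0"
  proof -
    obtain l where m: "m = Suc l"
      using \<open>m > 0\<close> by (cases m) auto
    have "fps_deriv f * w ^ Suc m = (w * fps_deriv f) * (w * w ^ l)"
      by (simp only: m power_Suc ac_simps)
    also have "\<dots> = - (fps_deriv w * (f * (w * w ^ l)))"
      by (simp only: \<open>w * fps_deriv f = _\<close> mult_minus_left mult.assoc)
    finally show ?thesis
      by (simp only: fw m diff_Suc_1)
  qed
  have split: "fps_deriv (fps_X * f) * w ^ Suc m = w ^ m + fps_X * (fps_deriv f * w ^ Suc m)"
    using fw[of "w ^ m"] by (simp add: algebra_simps)
  show ?thesis
  proof (cases "m = 0")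
    case True
    then show ?thesis
      unfolding split by simp
  next
    case False
    have "of_nat m * (fps_deriv f * w ^ Suc m) $ (m - 1) = - (fps_deriv (w ^ m) $ (m - 1))"
      using False by (simp add: dw fps_deriv_power' mult.assoc del: fps_deriv_nth power_Suc)
    also have "\<dots> = - (of_nat m * (w ^ m) $ m)"
      using False by simp
    finally have "of_nat m * ((w ^ m) $ m + (fps_deriv f * w ^ Suc m) $ (m - 1)) = 0"
      by (simp add: distrib_left)
    then show ?thesis
      unfolding split using False by simp
  qed
qed

text \<open>Triangularity: if \<open>d\<close> is nonzero of subdegree m, the condition at n = m
  reads d_m (w_0)^(m+1) = 0, which is impossible.\<close>

lemma fps_eq_0_if_mult_power_nth_eq_0:
  fixes d w :: "'a::idom fps"
  assumes "w $ 0 \<noteq> 0" and "\<And>n. (d * w ^ Suc n) $ n = 0"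
  shows "d = 0"
proof (rule ccontr)
  assume "d \<noteq> 0"
  define m where "m = subdegree d"
  have "(d * w ^ Suc m) $ m = (\<Sum>i=0..m. d $ i * (w ^ Suc m) $ (m - i))"
    by (simp add: fps_mult_nth)
  also have "\<dots> = (\<Sum>i\<in>{m}. d $ i * (w ^ Suc m) $ (m - i))"
    by (rule sum.mono_neutral_right) (auto simp: m_def nth_less_subdegree_zero)
  also have "\<dots> = d $ m * (w $ 0) ^ Suc m"
    by (simp add: fps_nth_power_0)
  finally show False
    unfolding assms(2) using assms(1) \<open>d \<noteq> 0\<close> by (simp add: m_def)
qed

text \<open>
  Lagrange inversion with the inverse series eliminated: the usual statement describes
  \<open>\<kappa> = f \<circ> (t f)\<^bsup>\<langle>-1\<rangle>\<^esup>\<close>. Existence of an expansion of \<open>f\<close> in powers of \<open>t f\<close> is not needed, since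
  the functionals \<open>h \<mapsto> [t\<^sup>n] h' w\<^bsup>n+1\<^esup>\<close> determine \<open>h\<close> up to a constant.
\<close>

theorem fps_lagrange_inversion_X_mult:
  fixes f w \<kappa> :: "'a::{idom,ring_char_0} fps"
  assumes wf: "w * f = 1" and 0: "\<kappa> $ 0 = f $ 0"
    and \<kappa>: "\<And>n. of_nat (Suc n) * \<kappa> $ Suc n = (fps_deriv f * w ^ Suc n) $ n"
  shows "\<kappa> oo (fps_X * f) = f"
proof -
  let ?u = "fps_X * f"
  have fw: "f ^ i * w ^ Suc n = w ^ Suc (n - i)" if "i \<le> n" for i n
  proof -
    have "w ^ Suc n = w ^ i * w ^ Suc (n - i)"
      using that by (simp flip: power_add)
    then have "f ^ i * w ^ Suc n = (w * f) ^ i * w ^ Suc (n - i)"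
      by (simp only: power_mult_distrib ac_simps)
    then show ?thesis
      by (simp add: wf)
  qed
  have "(fps_deriv (\<kappa> oo ?u) * w ^ Suc n) $ n = (fps_deriv f * w ^ Suc n) $ n" for n
  proof -
    \<comment> \<open>Chain rule, arranged so that the composition comes last and can be expanded in
      powers of \<open>?u\<close>.\<close>
    have "fps_deriv (\<kappa> oo ?u) * w ^ Suc n
        = (fps_deriv ?u * w ^ Suc n) * (fps_deriv \<kappa> oo ?u)"
      by (subst fps_compose_deriv) (simp_all add: ac_simps)
    then have "(fps_deriv (\<kappa> oo ?u) * w ^ Suc n) $ n
        = (\<Sum>i=0..n. fps_deriv \<kappa> $ i * (fps_deriv ?u * w ^ Suc n * f ^ i) $ (n - i))"
      by (simp only: fps_mult_compose_X_mult_nth)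
    \<comment> \<open>By \<open>fw\<close>, the \<open>i\<close>-th term is the residue for the
      exponent \<open>n - i\<close>, so only \<open>i = n\<close> survives.\<close>
    also have "\<dots> = (\<Sum>i=0..n. (if i = n then fps_deriv \<kappa> $ i else 0))"
    proof (intro sum.cong refl)
      fix i assume i: "i \<in> {0..n}"
      then have "fps_deriv ?u * w ^ Suc n * f ^ i = fps_deriv ?u * w ^ Suc (n - i)"
        using fw[of i n] by (simp add: mult.assoc mult.commute[of _ "f ^ i"] del: power_Suc)
      then show "fps_deriv \<kappa> $ i * (fps_deriv ?u * w ^ Suc n * f ^ i) $ (n - i)
          = (if i = n then fps_deriv \<kappa> $ i else 0)"
        using i by (simp only: fps_residue_X_mult[OF wf]) auto
    qed
    also have "\<dots> = fps_deriv \<kappa> $ n"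
      by simp
    also have "\<dots> = (fps_deriv f * w ^ Suc n) $ n"
      using \<kappa>[of n] by simp
    finally show ?thesis .
  qed
  then have coeff: "((fps_deriv (\<kappa> oo ?u) - fps_deriv f) * w ^ Suc n) $ n = 0" for n
    by (simp only: left_diff_distrib fps_sub_nth diff_self)
  have "(w * f) $ 0 = 1"
    by (simp add: wf)
  then have "w $ 0 \<noteq> 0"
    by auto
  from fps_eq_0_if_mult_power_nth_eq_0[OF this coeff]
  have "fps_deriv (\<kappa> oo ?u) = fps_deriv f"
    by simp
  \<comment> \<open>Equal derivatives leave a constant, which is fixed by assumption
    \<open>0\<close>.\<close>
  then show ?thesis
    unfolding fps_deriv_eq_iff by (simp add: 0)
qed

section \<open>Translation of umbral evaluations into coefficients of generating functions\<close>

lemma fps_int_pow_of_nat: "fps_int_pow f (int n) = f ^ n"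
  by (simp add: fps_int_pow_def)

lemma fps_int_pow_minus_of_nat:
  "fps_int_pow f (- int (Suc n)) = fps_left_inverse f 1 ^ Suc n"
  by (simp add: fps_int_pow_def nat_add_distrib del: power_Suc)

lemma scal_of_nat: "scal (of_nat n) = of_nat n"
  by (induction n) (simp_all add: scal_def single_add)

context umbral_calculus
begin

lemma E_zero: "E 0 = 0"
  using E_add[of 0 0] by simp

lemma E_sum: "E (\<Sum>i\<in>S. p i) = (\<Sum>i\<in>S. E (p i))"
  by (induction S rule: infinite_finite_induct) (simp_all add: E_zero E_add)

lemma E_of_nat_mult: "E (of_nat n * p) = of_nat n * E p"
  using E_scal[of "of_nat n" p] by (simp add: scal_of_nat)

lemma E_mult_scal: "E (p * scal c) = E p * c"
  using E_scal[of c p] by (simp add: mult.commute)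

lemma E_scal': "E (scal c) = c"
  using E_scal[of c 1] by (simp add: E_one)

lemma E_umb_power: "E (umb \<alpha> ^ n) = fact n * gen_fun E \<alpha> $ n"
proof -
  have "(fact n :: complex poly) = [:fact n:]"
    by (metis of_nat_fact of_nat_poly)
  then show ?thesis
    by (simp add: gen_fun_def)
qed

lemma gen_fun_nth_0: "gen_fun E \<alpha> $ 0 = 1"
  by (simp add: gen_fun_def E_one)

lemma gen_fun_eq_if_is_dot:
  assumes "is_dot E x \<alpha> \<beta>"
  shows "gen_fun E \<beta> = fps_int_pow (gen_fun E \<alpha>) x"
  using assms by (auto simp: is_dot_def gen_fun_def fps_eq_iff)

lemma gen_fun_dot: "finite F \<Longrightarrow> gen_fun E (dot E F x \<alpha>) = fps_int_pow (gen_fun E \<alpha>) x"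
  by (rule gen_fun_eq_if_is_dot) (rule is_dot_dot)

lemma E_umb_power_mult:
  assumes "\<alpha> \<noteq> \<beta>"
  shows "E (umb \<alpha> ^ i * umb \<beta> ^ j) = E (umb \<alpha> ^ i) * E (umb \<beta> ^ j)"
  using E_uncorrelated[of "{\<alpha>, \<beta>}" "\<lambda>x. if x = \<alpha> then i else j"] assms by auto

text \<open>Binomial theorem and uncorrelatedness. The case \<open>r = 0\<close> serves the array
  entries, \<open>r = 1\<close> the moments of the K umbra; the exact quotient of factorials is then
  1 or i + 1, respectively.\<close>

lemma E_umb_power_mult_add_power:
  assumes "\<alpha> \<noteq> \<beta>"
  shows "E (umb \<alpha> ^ r * (umb \<alpha> + umb \<beta>) ^ m)
    = fact m * (\<Sum>i=0..m. of_nat (fact (r + i) div fact i) * gen_fun E \<alpha> $ (r + i) * gen_fun E \<beta> $ (m - i))"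
proof -
  have coeff: "of_nat (m choose i) * (fact (r + i) * fact (m - i))
      = (fact m * of_nat (fact (r + i) div fact i) :: complex poly)" if "i \<le> m" for i
  proof -
    obtain d :: nat where d: "fact (r + i) = fact i * d"
      by (metis dvdE fact_dvd le_add2)
    have "(m choose i) * (fact (r + i) * fact (m - i)) = fact i * fact (m - i) * (m choose i) * d"
      by (simp only: d mult.assoc mult.commute mult.left_commute)
    also have "\<dots> = fact m * (fact (r + i) div fact i)"
      using binomial_fact_lemma[OF that] by (simp add: d)
    finally have "(m choose i) * (fact (r + i) * fact (m - i)) = fact m * (fact (r + i) div fact i :: nat)" .
    then show ?thesis
      by (metis of_nat_fact of_nat_mult)
  qed
  have "umb \<alpha> ^ r * (umb \<alpha> + umb \<beta>) ^ m
      = (\<Sum>i=0..m. of_nat (m choose i) * (umb \<alpha> ^ (r + i) * umb \<beta> ^ (m - i)))"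
    by (simp add: binomial_ring atLeast0AtMost sum_distrib_left power_add ac_simps)
  then have "E (umb \<alpha> ^ r * (umb \<alpha> + umb \<beta>) ^ m) = (\<Sum>i=0..m.
      (of_nat (m choose i) * (fact (r + i) * fact (m - i))) * (gen_fun E \<alpha> $ (r + i) * gen_fun E \<beta> $ (m - i)))"
    by (simp add: E_sum E_of_nat_mult E_umb_power_mult[OF assms] E_umb_power ac_simps)
  then show ?thesis
    by (simp add: coeff sum_distrib_left mult.assoc)
qed

text \<open>The classical description of the entries, multiplied by k! to avoid division in
  C[x].\<close>

lemma fact_mult_riordan:
  assumes "k \<le> n"
  shows "fact k * riordan E \<gamma> \<alpha> n k = fact n * (gen_fun E \<gamma> * gen_fun E \<alpha> ^ k) $ (n - k)"
proof -
  let ?\<beta> = "dot E {\<gamma>} (int k) \<alpha>"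
  have "\<gamma> \<noteq> ?\<beta>"
    using is_dot_dot(1)[of "{\<gamma>}" "int k" \<alpha>] by auto
  from E_umb_power_mult_add_power[OF this, of 0 "n - k"]
  have "E ((umb \<gamma> + umb ?\<beta>) ^ (n - k))
      = fact (n - k) * (gen_fun E \<gamma> * gen_fun E \<alpha> ^ k) $ (n - k)"
    by (simp add: fps_mult_nth gen_fun_dot fps_int_pow_of_nat)
  moreover have "fact k * fact (n - k) * of_nat (n choose k) = (fact n :: complex poly)"
    using binomial_fact_lemma[OF assms] by (metis of_nat_fact of_nat_mult)
  ultimately show ?thesis
    using assms by (simp add: riordan_def E_of_nat_mult ac_simps flip: \<open>_ = fact n\<close>)
qed

text \<open>The factor \<open>umb \<alpha>\<close> in the moment shifts the series of
  \<open>\<alpha>\<close> and contributes i + 1, which produces the derivative. This is the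
  coefficient hypothesis of \<open>fps_lagrange_inversion_X_mult\<close>.\<close>

lemma gen_fun_K_umbra_nth_Suc:
  "of_nat (Suc n) * gen_fun E (K_umbra E \<alpha> \<alpha>) $ Suc n
    = (fps_deriv (gen_fun E \<alpha>) * fps_left_inverse (gen_fun E \<alpha>) 1 ^ Suc n) $ n"
proof -
  let ?\<beta> = "dot E {\<alpha>} (- int (Suc n)) \<alpha>"
  have "\<alpha> \<noteq> ?\<beta>"
    using is_dot_dot(1)[of "{\<alpha>}" "- int (Suc n)" \<alpha>] by fastforce
  have "E (umb (K_umbra E \<alpha> \<alpha>) ^ Suc n) = E (umb \<alpha> ^ 1 * (umb \<alpha> + umb ?\<beta>) ^ n)"
    using is_K_umbra_K_umbra[of \<alpha> \<alpha>] unfolding is_K_umbra_def umbral_equiv_def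
    by (metis One_nat_def Suc_le_mono diff_Suc_1 le0 power_one_right)
  also have "\<dots> = fact n * (\<Sum>i=0..n. of_nat (Suc i) * gen_fun E \<alpha> $ Suc i
      * (fps_left_inverse (gen_fun E \<alpha>) 1 ^ Suc n) $ (n - i))"
    unfolding E_umb_power_mult_add_power[OF \<open>\<alpha> \<noteq> ?\<beta>\<close>]
    by (simp only: gen_fun_dot finite.intros fps_int_pow_minus_of_nat) simp
  also have "\<dots> = fact n * (fps_deriv (gen_fun E \<alpha>) * fps_left_inverse (gen_fun E \<alpha>) 1 ^ Suc n) $ n"
    by (simp add: fps_mult_nth del: power_Suc)
  finally show ?thesis
    unfolding E_umb_power by (simp add: ac_simps del: power_Suc of_nat_Suc)
qed

lemma gen_fun_K_umbra_compose:
  "gen_fun E (K_umbra E \<alpha> \<alpha>) oo (fps_X * gen_fun E \<alpha>) = gen_fun E \<alpha>"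
  by (rule fps_lagrange_inversion_X_mult[where w = "fps_left_inverse (gen_fun E \<alpha>) 1"])
     (simp_all only: gen_fun_K_umbra_nth_Suc gen_fun_nth_0 fps_left_inverse mult_1)

section \<open>The three identities as equations in C[x]\<close>

lemma riordan_recurrence_moments:
  assumes "1 \<le> k" "k \<le> n"
  shows "of_nat k * riordan E \<gamma> \<alpha> n k
    = of_nat n * (\<Sum>i=0..n-k. of_nat ((n-1) choose i) * E (umb \<alpha> ^ i) * riordan E \<gamma> \<alpha> (n-1-i) (k-1))"
proof -
  obtain l where k: "k = Suc l"
    using assms(1) by (cases k) auto
  obtain m where n: "n = Suc m"
    using assms by (cases n) auto
  let ?f = "gen_fun E \<alpha>" and ?g = "gen_fun E \<gamma>"
  \<comment> \<open>Scaled by l!, the summands are m! times the terms of the Cauchy product of f and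
    g f^l at index m - l = n - k.\<close>
  have "fact l * (of_nat (m choose i) * E (umb \<alpha> ^ i) * riordan E \<gamma> \<alpha> (m - i) l)
      = fact m * (?f $ i * (?g * ?f ^ l) $ (m - l - i))" if "i \<le> m - l" for i
  proof -
    have "i \<le> m" "l \<le> m - i" "m - i - l = m - l - i"
      using that assms k n by auto
    moreover have "fact i * fact (m - i) * of_nat (m choose i) = (fact m :: complex poly)"
      using binomial_fact_lemma[OF \<open>i \<le> m\<close>] by (metis of_nat_fact of_nat_mult)
    ultimately show ?thesis
      using fact_mult_riordan[of l "m - i" \<gamma> \<alpha>]
      by (simp add: E_umb_power ac_simps flip: \<open>_ = fact m\<close>)
  qed
  then have "fact l * (\<Sum>i=0..m-l. of_nat (m choose i) * E (umb \<alpha> ^ i) * riordan E \<gamma> \<alpha> (m - i) l)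
      = fact m * (?f * (?g * ?f ^ l)) $ (m - l)"
    by (simp add: fps_mult_nth[of ?f] sum_distrib_left)
  also have "?f * (?g * ?f ^ l) = ?g * ?f ^ k"
    by (simp add: k ac_simps)
  finally have "fact l * (of_nat k * riordan E \<gamma> \<alpha> n k) = fact l * (of_nat n *
      (\<Sum>i=0..m-l. of_nat (m choose i) * E (umb \<alpha> ^ i) * riordan E \<gamma> \<alpha> (m - i) l))"
    using fact_mult_riordan[OF assms(2), of \<gamma> \<alpha>] by (simp add: k n ac_simps del: of_nat_Suc)
  then show ?thesis
    by (simp add: k n)
qed

lemma riordan_recurrence_K_umbra:
  assumes "1 \<le> k" "k \<le> n"
  shows "of_nat k * riordan E \<gamma> \<alpha> n k
    = of_nat n * (\<Sum>i=0..n-k. of_nat ((k-1+i) choose i) * E (umb (K_umbra E \<alpha> \<alpha>) ^ i)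
        * riordan E \<gamma> \<alpha> (n-1) (k-1+i))"
proof -
  obtain l where k: "k = Suc l"
    using assms(1) by (cases k) auto
  obtain m where n: "n = Suc m"
    using assms by (cases n) auto
  let ?f = "gen_fun E \<alpha>" and ?g = "gen_fun E \<gamma>" and ?K = "K_umbra E \<alpha> \<alpha>"
  \<comment> \<open>The i! from the moment, the binomial and l! combine to (l+i)!, the factor that
    \<open>fact_mult_riordan\<close> requires.\<close>
  have "fact l * (of_nat ((l + i) choose i) * E (umb ?K ^ i) * riordan E \<gamma> \<alpha> m (l + i))
      = fact m * (gen_fun E ?K $ i * ((?g * ?f ^ l) * ?f ^ i) $ (m - l - i))" if "i \<le> m - l" for i
  proof -
    have "fact i * fact l * of_nat ((l + i) choose i) = (fact (l + i) :: complex poly)"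
      using binomial_fact_lemma[of i "l + i"] by (metis add_diff_cancel_right' le_add2 of_nat_fact of_nat_mult)
    then have "fact l * (of_nat ((l + i) choose i) * E (umb ?K ^ i) * riordan E \<gamma> \<alpha> m (l + i))
        = gen_fun E ?K $ i * (fact (l + i) * riordan E \<gamma> \<alpha> m (l + i))"
      by (simp add: E_umb_power ac_simps flip: \<open>_ = fact (l + i)\<close>)
    also have "\<dots> = gen_fun E ?K $ i * (fact m * (?g * ?f ^ (l + i)) $ (m - (l + i)))"
      using that assms k n by (subst fact_mult_riordan) auto
    finally show ?thesis
      by (simp add: power_add ac_simps)
  qed
  then have "fact l * (\<Sum>i=0..m-l. of_nat ((l + i) choose i) * E (umb ?K ^ i) * riordan E \<gamma> \<alpha> m (l + i))
      = fact m * (?g * ?f ^ l * (gen_fun E ?K oo (fps_X * ?f))) $ (m - l)"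
    by (simp add: fps_mult_compose_X_mult_nth sum_distrib_left)
  \<comment> \<open>The functional equation supplies the missing factor f.\<close>
  also have "?g * ?f ^ l * (gen_fun E ?K oo (fps_X * ?f)) = ?g * ?f ^ k"
    by (simp add: gen_fun_K_umbra_compose k ac_simps)
  finally have "fact l * (of_nat k * riordan E \<gamma> \<alpha> n k) = fact l * (of_nat n *
      (\<Sum>i=0..m-l. of_nat ((l + i) choose i) * E (umb ?K ^ i) * riordan E \<gamma> \<alpha> m (l + i)))"
    using fact_mult_riordan[OF assms(2), of \<gamma> \<alpha>] by (simp add: k n ac_simps del: of_nat_Suc)
  then show ?thesis
    by (simp add: k n)
qed

lemma riordan_eq_sum_dot_K_umbra:
  assumes "k \<le> n"
  shows "riordan E \<gamma> \<alpha> n k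
    = of_nat (n choose k) * (\<Sum>i=0..n-k. E (umb (dot E {} (int k) (K_umbra E \<alpha> \<alpha>)) ^ i)
        * riordan E \<gamma> \<alpha> (n-k) i)"
proof -
  let ?f = "gen_fun E \<alpha>" and ?g = "gen_fun E \<gamma>" and ?\<kappa> = "gen_fun E (K_umbra E \<alpha> \<alpha>)"
  let ?S = "\<Sum>i=0..n-k. E (umb (dot E {} (int k) (K_umbra E \<alpha> \<alpha>)) ^ i) * riordan E \<gamma> \<alpha> (n-k) i"
  \<comment> \<open>The umbra k.K has generating function \<open>?\<kappa> ^ k\<close>, and the i!
    of its moment goes to the array entry.\<close>
  have "?S = (\<Sum>i=0..n-k. (?\<kappa> ^ k) $ i * (fact i * riordan E \<gamma> \<alpha> (n-k) i))"
    by (simp add: E_umb_power gen_fun_dot fps_int_pow_of_nat ac_simps)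
  also have "\<dots> = (\<Sum>i=0..n-k. (?\<kappa> ^ k) $ i * (fact (n - k) * (?g * ?f ^ i) $ (n - k - i)))"
    by (intro sum.cong refl) (simp add: fact_mult_riordan)
  also have "\<dots> = fact (n - k) * (?g * ((?\<kappa> ^ k) oo (fps_X * ?f))) $ (n - k)"
    by (simp add: fps_mult_compose_X_mult_nth sum_distrib_left ac_simps)
  \<comment> \<open>Composition is multiplicative, so all k factors are replaced at once.\<close>
  also have "(?\<kappa> ^ k) oo (fps_X * ?f) = ?f ^ k"
    by (simp add: gen_fun_K_umbra_compose flip: fps_compose_power)
  finally have S: "?S = fact (n - k) * (?g * ?f ^ k) $ (n - k)" .
  have "fact k * fact (n - k) * of_nat (n choose k) = (fact n :: complex poly)"
    using binomial_fact_lemma[OF assms] by (metis of_nat_fact of_nat_mult)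
  then have "fact k * riordan E \<gamma> \<alpha> n k = fact k * (of_nat (n choose k) * ?S)"
    unfolding fact_mult_riordan[OF assms] S by (simp add: ac_simps flip: \<open>_ = fact n\<close>)
  then show ?thesis
    by simp
qed

end

text \<open>The rational factor n/k becomes a constant polynomial; k cancels because C[x] is a
  domain of characteristic 0.\<close>

lemma eq_pCons_divide_mult_if_of_nat_mult_eq:
  fixes p q :: "complex poly"
  assumes "k \<noteq> 0" and "of_nat k * p = of_nat n * q"
  shows "p = [:of_nat n / of_nat k:] * q"
proof -
  have "of_nat k * ([:of_nat n / of_nat k:] * q) = (of_nat n * q :: complex poly)"
    using assms(1) by (simp add: of_nat_poly)
  then have "of_nat k * p = of_nat k * ([:of_nat n / of_nat k:] * q)"
    by (simp only: assms(2))
  then show ?thesis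
    using assms(1) by (simp only: mult_cancel_left of_nat_eq_0_iff) simp
qed

theorem theorem2p6:
  fixes E :: "'a umbral_poly \<Rightarrow> complex poly" and \<gamma> \<alpha> :: 'a and n k :: nat
  assumes "umbral_calculus E" and "1 \<le> k" and "k \<le> n"
  shows
    "(scal (riordan E \<gamma> \<alpha> n k) \<simeq>\<^bsub>E\<^esub>
       scal [:of_nat n / of_nat k:] *
         (\<Sum>i=0..n-k. of_nat ((n-1) choose i) * umb \<alpha> ^ i * scal (riordan E \<gamma> \<alpha> (n-1-i) (k-1))))
   \<and> (scal (riordan E \<gamma> \<alpha> n k) \<simeq>\<^bsub>E\<^esub>
       scal [:of_nat n / of_nat k:] *
         (\<Sum>i=0..n-k. of_nat ((k-1+i) choose i) * umb (K_umbra E \<alpha> \<alpha>) ^ i *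
            scal (riordan E \<gamma> \<alpha> (n-1) (k-1+i))))
   \<and> (scal (riordan E \<gamma> \<alpha> n k) \<simeq>\<^bsub>E\<^esub>
       of_nat (n choose k) *
         (\<Sum>i=0..n-k. umb (dot E {} (int k) (K_umbra E \<alpha> \<alpha>)) ^ i *
            scal (riordan E \<gamma> \<alpha> (n-k) i)))"
proof -
  interpret umbral_calculus E
    by (rule assms(1))
  have "k \<noteq> 0"
    using assms(2) by simp
  note 1 = eq_pCons_divide_mult_if_of_nat_mult_eq[OF this
      riordan_recurrence_moments[OF assms(2,3), of \<gamma> \<alpha>]]
    and 2 = eq_pCons_divide_mult_if_of_nat_mult_eq[OF this
      riordan_recurrence_K_umbra[OF assms(2,3), of \<gamma> \<alpha>]]
    and 3 = riordan_eq_sum_dot_K_umbra[OF assms(3), of \<gamma> \<alpha>]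
  show ?thesis
    unfolding umbral_equiv_def E_scal E_scal' E_of_nat_mult E_sum E_mult_scal
    using 1 2 3 by (intro conjI)
qed

end
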